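(* Assume $K(x,y)>0$, $\mu(x)>0$, $\nu(y)>0$ for all $x,y\in S$. For every $g\in\mathbb R^S$ the operator $\mathsf K_g$ is symmetric and positive semidefinite, and for every $f\in\mathbb R^S$, $$\langle f,\mathsf K_g f\rangle=\sum_{x\in S}\mu(x)\operatorname{Var}_{p_g(\cdot|x)}(f)=\frac12\sum_{y,z\in S}A_g(y,z)\,(f(y)-f(z))^2,\qquad A_g(y,z)=\sum_{x\in S}\mu(x)p_g(y|x)p_g(z|x).$$ The coefficients $A_g(y,z)$ are symmetric in $(y,z)$ and strictly positive for all $y,z\in S$. Moreover, $\mathsf K_g\mathbf 1=0$; $\langle f,\mathsf K_g f\rangle=0$ if and only if $f$ is constant on $S$; and consequently $\mathsf K_g$ is strictly positive on $\mathcal H$, i.e. $\langle f,\mathsf K_g f\rangle>0$ for all $f\in\mathcal H\setminus\{0\}$.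
   Context: Let $N\ge1$ be an integer and $S=\{1,\dots,N\}$. Let $Q\in\mathbb R^{N\times N}$ be the generator of a continuous-time Markov chain on $S$ (nonnegative off-diagonal entries, rows summing to zero) and $K=e^{Q}$. Let $\mu,\nu$ be probability distributions on $S$. $\langle\cdot,\cdot\rangle$ is the standard Euclidean inner product on $\mathbb R^S$; $\mathbf 1$ is the constant function $1$; $\operatorname{Var}_p(f)$ is the variance of $f$ under the probability distribution $p$ on $S$. For $g\in\mathbb R^S$ set $Z_g(x)=\sum_{z\in S}K(x,z)e^{g(z)}$, $p_g(y|x)=\frac{K(x,y)e^{g(y)}}{Z_g(x)}$, $m_g(y)=\sum_{x\in S}\mu(x)p_g(y|x)$. The gauge-fixed space is $\mathcal H=\{g\in\mathbb R^S:\sum_{y\in S}\nu(y)g(y)=0\}$. The operator $\mathsf K_g:\mathbb R^S\to\mathbb R^S$ is the differential of $g\mapsto m_g$ at $g$: $$\mathsf K_g=Dm_g=\sum_{x\in S}\mu(x)\left[\operatorname{Diag}(p_g(\cdot|x))-p_g(\cdot|x)p_g(\cdot|x)^\top\right].$$ *)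

theory Defs
  imports "HOL-Analysis.Analysis" "HOL-Probability.Probability"
begin

text \<open>
  The state space is a finite type \<open>'n\<close>, functions on it are vectors in \<open>real ^ 'n\<close>,
  and \<open>Q $ x $ y\<close> is the entry in row \<open>x\<close> and column \<open>y\<close>.
\<close>

definition is_generator :: "real ^ 'n ^ 'n \<Rightarrow> bool" where
  "is_generator Q \<longleftrightarrow>
     (\<forall>x y. x \<noteq> y \<longrightarrow> 0 \<le> Q $ x $ y) \<and> (\<forall>x. (\<Sum>y\<in>UNIV. Q $ x $ y) = 0)"

text \<open>
  The library's \<open>exp\<close> does not apply to matrices: multiplication \<open>*\<close> on vectors of vectors is
  entrywise, so the exponential series is written out with the matrix product \<open>**\<close>.
\<close>

definition mat_exp :: "real ^ 'n ^ 'n \<Rightarrow> real ^ 'n ^ 'n" where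
  "mat_exp Q = (\<Sum>k. (1 / fact k) *\<^sub>R (((**) Q ^^ k) (mat 1)))"

definition Zfun :: "real ^ 'n ^ 'n \<Rightarrow> real ^ 'n \<Rightarrow> 'n \<Rightarrow> real" where
  "Zfun K g x = (\<Sum>z\<in>UNIV. K $ x $ z * exp (g $ z))"

definition ptilt :: "real ^ 'n ^ 'n \<Rightarrow> real ^ 'n \<Rightarrow> 'n \<Rightarrow> 'n \<Rightarrow> real" where
  "ptilt K g x y = K $ x $ y * exp (g $ y) / Zfun K g x"

text \<open>
  \<open>tilt_pmf K g x\<close> is \<open>ptilt K g x\<close> as a probability distribution; \<open>embed_pmf\<close> is only meaningful
  for nonnegative weights of total mass one, see \<open>pmf_tilt_pmf\<close> below.
\<close>

definition tilt_pmf :: "real ^ 'n ^ 'n \<Rightarrow> real ^ 'n \<Rightarrow> 'n \<Rightarrow> 'n pmf" where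
  "tilt_pmf K g x = embed_pmf (ptilt K g x)"

definition marg :: "'n pmf \<Rightarrow> real ^ 'n ^ 'n \<Rightarrow> real ^ 'n \<Rightarrow> real ^ 'n" where
  "marg \<mu> K g = (\<chi> y. \<Sum>x\<in>UNIV. pmf \<mu> x * ptilt K g x y)"

text \<open>
  The differential of \<open>g \<mapsto> m\<^sub>g\<close>. Differentiability and the explicit formula
  \<open>\<Sum>x. \<mu>(x) (Diag p\<^sub>g(\<cdot>|x) - p\<^sub>g(\<cdot>|x) p\<^sub>g(\<cdot>|x)\<^sup>T)\<close> are established below.
\<close>

definition Kop :: "'n pmf \<Rightarrow> real ^ 'n ^ 'n \<Rightarrow> real ^ 'n \<Rightarrow> real ^ 'n \<Rightarrow> real ^ 'n" where
  "Kop \<mu> K g = frechet_derivative (marg \<mu> K) (at g)"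

definition Acoef :: "'n pmf \<Rightarrow> real ^ 'n ^ 'n \<Rightarrow> real ^ 'n \<Rightarrow> 'n \<Rightarrow> 'n \<Rightarrow> real" where
  "Acoef \<mu> K g y z = (\<Sum>x\<in>UNIV. pmf \<mu> x * ptilt K g x y * ptilt K g x z)"

definition gauge_space :: "'n pmf \<Rightarrow> (real ^ 'n) set" where
  "gauge_space \<nu> = {g. (\<Sum>y\<in>UNIV. pmf \<nu> y * g $ y) = 0}"

definition Kmat :: "'n pmf \<Rightarrow> real ^ 'n ^ 'n \<Rightarrow> real ^ 'n \<Rightarrow> real ^ 'n ^ 'n" where
  "Kmat \<mu> K g = (\<Sum>x\<in>UNIV. pmf \<mu> x *\<^sub>R
     (\<chi> y z. (if y = z then ptilt K g x y else 0) - ptilt K g x y * ptilt K g x z))"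

lemma Zfun_pos:
  assumes "\<And>x y. 0 < K $ x $ y"
  shows "0 < Zfun K g x"
  unfolding Zfun_def by (intro sum_pos) (auto simp: assms)

lemma sum_ptilt:
  assumes "\<And>x y. 0 < K $ x $ y"
  shows "(\<Sum>y\<in>UNIV. ptilt K g x y) = 1"
proof -
  have "(\<Sum>y\<in>UNIV. ptilt K g x y) = Zfun K g x / Zfun K g x"
    unfolding ptilt_def sum_divide_distrib [symmetric] by (simp add: Zfun_def)
  then show ?thesis
    using Zfun_pos [of K g x] assms by simp
qed

lemma ptilt_pos:
  assumes "\<And>x y. 0 < K $ x $ y"
  shows "0 < ptilt K g x y"
  unfolding ptilt_def using Zfun_pos [of K g x] assms by simp

lemma pmf_tilt_pmf:
  assumes "\<And>x y. 0 < K $ x $ y"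
  shows "pmf (tilt_pmf K g x) y = ptilt K g x y"
  unfolding tilt_pmf_def
proof (rule pmf_embed_pmf)
  show nonneg: "0 \<le> ptilt K g x y" for y
    using ptilt_pos [of K g x y] assms by simp
  show "(\<integral>\<^sup>+ y. ennreal (ptilt K g x y) \<partial>count_space UNIV) = 1"
    using sum_ptilt [of K g x] assms nonneg
    by (simp add: nn_integral_count_space_finite sum_ennreal)
qed

lemma ptilt_has_derivative:
  fixes K :: "real ^ 'n ^ 'n"
  assumes K: "\<And>x y. 0 < K $ x $ y"
  shows "((\<lambda>g. ptilt K g x y) has_derivative
           (\<lambda>h. ptilt K g x y * (h $ y - (\<Sum>z\<in>UNIV. ptilt K g x z * h $ z)))) (at g)"
proof -
  have Z: "Zfun K g x \<noteq> 0"
    using Zfun_pos [of K g x] K by simp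
  have n: "((\<lambda>g. g $ z) has_derivative (\<lambda>h. h $ z)) (at g)" for z :: 'n and g :: "real ^ 'n"
    by (rule bounded_linear.has_derivative [OF bounded_linear_vec_nth has_derivative_ident])
  have num: "((\<lambda>g. K $ x $ z * exp (g $ z)) has_derivative
              (\<lambda>h. K $ x $ z * exp (g $ z) * h $ z)) (at g)" for z
    by (auto intro!: derivative_eq_intros n)
  have den: "((\<lambda>g. Zfun K g x) has_derivative
              (\<lambda>h. \<Sum>z\<in>UNIV. K $ x $ z * exp (g $ z) * h $ z)) (at g)"
    unfolding Zfun_def by (intro has_derivative_sum num)
  have eq: "(\<Sum>z\<in>UNIV. ptilt K g x z * h $ z) =
        (\<Sum>z\<in>UNIV. K $ x $ z * exp (g $ z) * h $ z) / Zfun K g x" for h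
    by (simp add: ptilt_def sum_divide_distrib)
  show ?thesis
    unfolding eq unfolding ptilt_def
    apply (rule has_derivative_eq_rhs [OF has_derivative_divide' [OF num den Z]])
    using Z by (auto simp: field_simps power2_eq_square)
qed

lemma Kmat_mult_nth:
  fixes K :: "real ^ 'n ^ 'n"
  shows "(Kmat \<mu> K g *v h) $ y = (\<Sum>x\<in>UNIV. pmf \<mu> x *
     (ptilt K g x y * (h $ y - (\<Sum>z\<in>UNIV. ptilt K g x z * h $ z))))"
proof -
  have "(Kmat \<mu> K g *v h) $ y = (\<Sum>z\<in>UNIV. \<Sum>x\<in>UNIV. pmf \<mu> x *
     (((if y = z then ptilt K g x y else 0) - ptilt K g x y * ptilt K g x z) * h $ z))"
    by (simp add: Kmat_def matrix_vector_mult_def sum_distrib_right mult.assoc)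
  also have "\<dots> = (\<Sum>x\<in>UNIV. pmf \<mu> x * (\<Sum>z\<in>UNIV.
     ((if y = z then ptilt K g x y else 0) - ptilt K g x y * ptilt K g x z) * h $ z))"
    by (subst sum.swap) (simp add: sum_distrib_left)
  also have "\<dots> = (\<Sum>x\<in>UNIV. pmf \<mu> x *
     (ptilt K g x y * (h $ y - (\<Sum>z\<in>UNIV. ptilt K g x z * h $ z))))"
    by (simp add: left_diff_distrib right_diff_distrib sum_subtractf sum_distrib_left
        if_distrib [where f = "\<lambda>t. t * _"] mult.assoc cong: if_cong)
  finally show ?thesis .
qed

lemma marg_has_derivative:
  fixes K :: "real ^ 'n ^ 'n"
  assumes K: "\<And>x y. 0 < K $ x $ y"
  shows "(marg \<mu> K has_derivative (\<lambda>h. Kmat \<mu> K g *v h)) (at g)"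
proof (subst has_derivative_componentwise_within, intro ballI)
  fix i :: "real ^ 'n" assume "i \<in> Basis"
  then obtain y where i: "i = axis y 1"
    by (auto simp: Basis_vec_def)
  have "((\<lambda>g. \<Sum>x\<in>UNIV. pmf \<mu> x * ptilt K g x y) has_derivative
      (\<lambda>h. \<Sum>x\<in>UNIV. pmf \<mu> x *
        (ptilt K g x y * (h $ y - (\<Sum>z\<in>UNIV. ptilt K g x z * h $ z))))) (at g)"
    by (intro has_derivative_sum has_derivative_mult_right ptilt_has_derivative K)
  then show "((\<lambda>g. marg \<mu> K g \<bullet> i) has_derivative (\<lambda>h. (Kmat \<mu> K g *v h) \<bullet> i)) (at g)"
    by (simp add: i inner_axis Kmat_mult_nth marg_def)
qed

lemma Kop_eq_Kmat:
  assumes "\<And>x y. 0 < K $ x $ y"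
  shows "Kop \<mu> K g = (\<lambda>h. Kmat \<mu> K g *v h)"
  unfolding Kop_def using marg_has_derivative [of K \<mu> g] assms
  by (simp add: frechet_derivative_at [symmetric])

end

theory Submission imports Defs begin

text \<open>
  Each \<open>p\<^sub>g(\<cdot>|x)\<close> contributes to \<open>\<langle>u, K\<^sub>g v\<rangle>\<close> the covariance of \<open>u\<close> and \<open>v\<close> under that distribution,
  with weight \<open>\<mu>(x)\<close>. A covariance equals half the mean of the product of the increments
  \<open>u(y) - u(z)\<close> and \<open>v(y) - v(z)\<close> over two independent samples \<open>y\<close>, \<open>z\<close>. Averaging over \<open>\<mu>\<close> turns
  \<open>\<langle>u, K\<^sub>g v\<rangle>\<close> into a Dirichlet form on \<open>'n\<close> with conductances \<open>A\<^sub>g(y,z)\<close> (lemma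
  \<open>inner_Kop_eq_Dirichlet\<close>). All the claims are visible on that form: it is symmetric in \<open>u\<close> and \<open>v\<close>,
  it is a sum of squares for \<open>u = v\<close>, and since every conductance is positive its kernel consists
  of the functions without increments, that is, the constants. The gauge condition removes the
  nonzero constants, because the \<open>\<nu>\<close>-mean of a constant is that constant.
\<close>

lemma weighted_covariance_eq:
  fixes p u v :: "'a \<Rightarrow> real"
  assumes p: "sum p S = 1"
  shows "(\<Sum>y\<in>S. u y * (p y * (v y - (\<Sum>z\<in>S. p z * v z))))
    = 1 / 2 * (\<Sum>y\<in>S. \<Sum>z\<in>S. p y * p z * ((u y - u z) * (v y - v z)))"
proof -
  define U V W where "U = (\<Sum>y\<in>S. p y * u y)" and "V = (\<Sum>y\<in>S. p y * v y)"
    and "W = (\<Sum>y\<in>S. p y * (u y * v y))"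
  have inner: "(\<Sum>z\<in>S. p y * p z * ((u y - u z) * (v y - v z)))
      = p y * (u y * v y) - p y * u y * V - p y * v y * U + p y * W" for y
  proof -
    have "(\<Sum>z\<in>S. p y * p z * ((u y - u z) * (v y - v z)))
        = (\<Sum>z\<in>S. p y * (u y * v y) * p z - p y * u y * (p z * v z)
            - p y * v y * (p z * u z) + p y * (p z * (u z * v z)))"
      by (intro sum.cong refl) (simp add: algebra_simps)
    then show ?thesis
      by (simp add: sum.distrib sum_subtractf p U_def V_def W_def flip: sum_distrib_left)
  qed
  have "(\<Sum>y\<in>S. \<Sum>z\<in>S. p y * p z * ((u y - u z) * (v y - v z))) = 2 * (W - U * V)"
    unfolding inner
    by (simp add: sum.distrib sum_subtractf p flip: sum_distrib_right U_def V_def W_def)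
  moreover have "(\<Sum>y\<in>S. u y * (p y * (v y - V))) = W - U * V"
    unfolding U_def W_def sum_distrib_right sum_subtractf [symmetric]
    by (intro sum.cong refl) (simp add: algebra_simps)
  ultimately show ?thesis
    by (simp add: V_def)
qed

lemma variance_pmf_eq_covariance:
  fixes q :: "'n::finite pmf" and f :: "'n \<Rightarrow> real"
  shows "measure_pmf.variance q f
    = (\<Sum>y\<in>UNIV. f y * (pmf q y * (f y - (\<Sum>z\<in>UNIV. pmf q z * f z))))"
proof -
  define m where "m = (\<Sum>z\<in>UNIV. pmf q z * f z)"
  have E: "measure_pmf.expectation q h = (\<Sum>y\<in>UNIV. pmf q y * h y)" for h :: "'n \<Rightarrow> real"
    by (subst integral_measure_pmf_real [of UNIV]) (auto simp: mult.commute)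
  have total: "(\<Sum>y\<in>UNIV. pmf q y) = 1"
    by (simp add: sum_pmf_eq_1)
  \<comment> \<open>The two sides differ by \<open>m\<close> times the mean of \<open>f - m\<close>, which vanishes.\<close>
  have "(\<Sum>y\<in>UNIV. pmf q y * (f y - m)\<^sup>2)
      = (\<Sum>y\<in>UNIV. f y * (pmf q y * (f y - m)) - m * (pmf q y * f y) + m * m * pmf q y)"
    by (intro sum.cong refl) (simp add: algebra_simps power2_eq_square)
  also have "\<dots> = (\<Sum>y\<in>UNIV. f y * (pmf q y * (f y - m)))"
    by (simp add: sum.distrib sum_subtractf total flip: sum_distrib_left m_def)
  finally show ?thesis
    by (simp add: E m_def)
qed

lemma inner_Kop_eq_covariances:
  fixes K :: "real ^ 'n ^ 'n"
  assumes K: "\<And>x y. 0 < K $ x $ y"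
  shows "u \<bullet> Kop \<mu> K g v = (\<Sum>x\<in>UNIV. pmf \<mu> x *
    (\<Sum>y\<in>UNIV. u $ y * (ptilt K g x y * (v $ y - (\<Sum>z\<in>UNIV. ptilt K g x z * v $ z)))))"
proof -
  have "u \<bullet> Kop \<mu> K g v = (\<Sum>y\<in>UNIV. \<Sum>x\<in>UNIV. pmf \<mu> x *
      (u $ y * (ptilt K g x y * (v $ y - (\<Sum>z\<in>UNIV. ptilt K g x z * v $ z)))))"
    by (simp add: Kop_eq_Kmat K inner_vec_def Kmat_mult_nth sum_distrib_left [of "u $ _"]
        mult.left_commute)
  then show ?thesis
    by (subst (asm) sum.swap) (simp flip: sum_distrib_left)
qed

text \<open>
  The polarised form of the Dirichlet identity: with two different arguments it shows at once that
  the operator is symmetric and that it annihilates constants.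
\<close>

lemma inner_Kop_eq_Dirichlet:
  fixes K :: "real ^ 'n ^ 'n"
  assumes K: "\<And>x y. 0 < K $ x $ y"
  shows "u \<bullet> Kop \<mu> K g v = 1 / 2 *
    (\<Sum>y\<in>UNIV. \<Sum>z\<in>UNIV. Acoef \<mu> K g y z * ((u $ y - u $ z) * (v $ y - v $ z)))"
proof -
  have "u \<bullet> Kop \<mu> K g v = (\<Sum>x\<in>UNIV. pmf \<mu> x * (1 / 2 * (\<Sum>y\<in>UNIV. \<Sum>z\<in>UNIV.
      ptilt K g x y * ptilt K g x z * ((u $ y - u $ z) * (v $ y - v $ z)))))"
    by (simp only: inner_Kop_eq_covariances [OF K] weighted_covariance_eq [OF sum_ptilt [OF K]])
  also have "\<dots> = 1 / 2 * (\<Sum>x\<in>UNIV. \<Sum>y\<in>UNIV. \<Sum>z\<in>UNIV.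
      pmf \<mu> x * ptilt K g x y * ptilt K g x z * ((u $ y - u $ z) * (v $ y - v $ z)))"
    by (simp add: sum_distrib_left mult.assoc mult.left_commute)
  also have "\<dots> = 1 / 2 * (\<Sum>y\<in>UNIV. \<Sum>z\<in>UNIV. \<Sum>x\<in>UNIV.
      pmf \<mu> x * ptilt K g x y * ptilt K g x z * ((u $ y - u $ z) * (v $ y - v $ z)))"
    by (subst sum.swap, subst (2) sum.swap) (rule refl)
  finally show ?thesis
    by (simp add: Acoef_def sum_distrib_right)
qed

lemma inner_Kop_eq_variances:
  fixes K :: "real ^ 'n ^ 'n"
  assumes K: "\<And>x y. 0 < K $ x $ y"
  shows "f \<bullet> Kop \<mu> K g f
    = (\<Sum>x\<in>UNIV. pmf \<mu> x * measure_pmf.variance (tilt_pmf K g x) (\<lambda>y. f $ y))"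
  by (simp only: inner_Kop_eq_covariances [OF K] variance_pmf_eq_covariance pmf_tilt_pmf [OF K])

lemma Acoef_commute: "Acoef \<mu> K g y z = Acoef \<mu> K g z y"
  by (simp add: Acoef_def mult_ac)

lemma Acoef_pos:
  fixes K :: "real ^ 'n ^ 'n"
  assumes K: "\<And>x y. 0 < K $ x $ y" and "\<And>x. 0 < pmf \<mu> x"
  shows "0 < Acoef \<mu> K g y z"
  unfolding Acoef_def by (intro sum_pos mult_pos_pos ptilt_pos assms) auto

lemma Dirichlet_form_eq_0_iff:
  fixes A :: "'n::finite \<Rightarrow> 'n \<Rightarrow> real" and f :: "'n \<Rightarrow> real"
  assumes A: "\<And>y z. 0 < A y z"
  shows "(\<Sum>y\<in>UNIV. \<Sum>z\<in>UNIV. A y z * (f y - f z)\<^sup>2) = 0 \<longleftrightarrow> (\<exists>c. \<forall>y. f y = c)"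
proof -
  have "(\<Sum>y\<in>UNIV. \<Sum>z\<in>UNIV. A y z * (f y - f z)\<^sup>2) = 0
      \<longleftrightarrow> (\<forall>y z. A y z * (f y - f z)\<^sup>2 = 0)"
    using A by (simp add: sum_nonneg_eq_0_iff sum_nonneg less_imp_le)
  also have "\<dots> \<longleftrightarrow> (\<forall>y z. f y = f z)"
    using A by (simp add: less_imp_neq [THEN not_sym])
  also have "\<dots> \<longleftrightarrow> (\<exists>c. \<forall>y. f y = c)"
    by metis
  finally show ?thesis .
qed

lemma constant_in_gauge_space_eq_0:
  fixes f :: "real ^ 'n"
  assumes "f \<in> gauge_space \<nu>" and c: "\<And>y. f $ y = c"
  shows "f = 0"
proof -
  have "(\<Sum>y\<in>UNIV. pmf \<nu> y) * c = 0"
    using assms by (simp add: gauge_space_def sum_distrib_right)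
  then show ?thesis
    by (simp add: sum_pmf_eq_1 c vec_eq_iff)
qed

theorem mainTheorem8:
  fixes Q K :: "real ^ 'n ^ 'n" and \<mu> \<nu> :: "'n pmf" and g :: "real ^ 'n"
  assumes "is_generator Q"
    and "K = mat_exp Q"
    and "\<forall>x y. 0 < K $ x $ y"
    and "\<forall>x. 0 < pmf \<mu> x"
    and "\<forall>y. 0 < pmf \<nu> y"
  shows "linear (Kop \<mu> K g)
    \<and> (\<forall>u v. u \<bullet> Kop \<mu> K g v = Kop \<mu> K g u \<bullet> v)
    \<and> (\<forall>f. 0 \<le> f \<bullet> Kop \<mu> K g f)
    \<and> (\<forall>f. f \<bullet> Kop \<mu> K g f
            = (\<Sum>x\<in>UNIV. pmf \<mu> x * measure_pmf.variance (tilt_pmf K g x) (\<lambda>y. f $ y))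
          \<and> (\<Sum>x\<in>UNIV. pmf \<mu> x * measure_pmf.variance (tilt_pmf K g x) (\<lambda>y. f $ y))
            = 1 / 2 * (\<Sum>y\<in>UNIV. \<Sum>z\<in>UNIV. Acoef \<mu> K g y z * (f $ y - f $ z)\<^sup>2))
    \<and> (\<forall>y z. Acoef \<mu> K g y z = Acoef \<mu> K g z y)
    \<and> (\<forall>y z. 0 < Acoef \<mu> K g y z)
    \<and> Kop \<mu> K g (\<chi> y. 1) = 0
    \<and> (\<forall>f. f \<bullet> Kop \<mu> K g f = 0 \<longleftrightarrow> (\<exists>c. \<forall>y. f $ y = c))
    \<and> (\<forall>f \<in> gauge_space \<nu> - {0}. 0 < f \<bullet> Kop \<mu> K g f)"
proof -
  have K: "0 < K $ x $ y" and mu: "0 < pmf \<mu> x" for x y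
    using assms by auto
  note form = inner_Kop_eq_Dirichlet [where \<mu> = \<mu> and g = g, OF K]
  note variances = inner_Kop_eq_variances [where \<mu> = \<mu> and g = g, OF K]
  note A_pos = Acoef_pos [where g = g, OF K mu]
  have quadratic: "f \<bullet> Kop \<mu> K g f
      = 1 / 2 * (\<Sum>y\<in>UNIV. \<Sum>z\<in>UNIV. Acoef \<mu> K g y z * (f $ y - f $ z)\<^sup>2)" for f
    by (simp add: form power2_eq_square)
  have lin: "linear (Kop \<mu> K g)"
    by (simp add: Kop_eq_Kmat K)
  have sym: "u \<bullet> Kop \<mu> K g v = Kop \<mu> K g u \<bullet> v" for u v
    by (simp add: inner_commute [of "Kop \<mu> K g u"] form mult.commute [of "u $ _ - u $ _"])
  have nonneg: "0 \<le> f \<bullet> Kop \<mu> K g f" for f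
    unfolding quadratic by (simp add: sum_nonneg A_pos less_imp_le)
  have kernel: "f \<bullet> Kop \<mu> K g f = 0 \<longleftrightarrow> (\<exists>c. \<forall>y. f $ y = c)" for f
    unfolding quadratic using Dirichlet_form_eq_0_iff [OF A_pos] by simp
  have one: "Kop \<mu> K g (\<chi> y. 1) = 0"
  proof -
    have "Kop \<mu> K g (\<chi> y. 1) \<bullet> Kop \<mu> K g (\<chi> y. 1) = 0"
      by (subst form) simp
    then show ?thesis by simp
  qed
  have gauge: "0 < f \<bullet> Kop \<mu> K g f" if "f \<in> gauge_space \<nu> - {0}" for f
  proof -
    have "f \<bullet> Kop \<mu> K g f \<noteq> 0"
      unfolding kernel using that constant_in_gauge_space_eq_0 by blast
    then show ?thesis
      using nonneg [of f] by simp
  qed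
  show ?thesis
    by (intro conjI allI ballI lin sym nonneg variances trans [OF variances [symmetric] quadratic]
        Acoef_commute A_pos one kernel gauge)
qed

end
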